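(* Let $k \ge 3$ be an integer and let $\overrightarrow{C_k}$ denote the directed cycle on $k$ vertices. For every arc-weighted directed multigraph $D$, $$\tau_k(D) \le \frac{2k}{3}\,\nu_k^*(D).$$ Moreover, for $k=5$, every arc-weighted directed multigraph $D$ satisfies $\tau_5(D) \le \frac{25}{8}\,\nu_5^*(D)$.
   Context: Directed multigraphs have no loops but may contain directed cycles of length 2 and several parallel arcs in the same direction. An arc-weighted directed multigraph $D$ has a non-negative weight $w(e)$ on each arc $e$. For a directed graph $H$, an $H$-copy in $D$ is a subgraph of $D$ isomorphic to $H$. $\tau_H(D)$ is the minimum total weight of a set $F$ of arcs of $D$ such that $D\setminus F$ (the spanning subgraph obtained by deleting the arcs of $F$) contains no $H$-copy. A fractional $H$-packing of $D$ is a function $m$ from the set of $H$-copies of $D$ to $[0,\infty)$ such that for every arc $e$, the sum of $m(X)$ over all $H$-copies $X$ containing $e$ is at most $w(e)$; its value is $\sum_X m(X)$, and $\nu_H^*(D)$ is the maximum value of a fractional $H$-packing. The subscript $k$ abbreviates the subscript $\overrightarrow{C_k}$, i.e. $\tau_k=\tau_{\overrightarrow{C_k}}$ and $\nu_k^*=\nu^*_{\overrightarrow{C_k}}$. *)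

theory Defs
  imports "HOL-Analysis.Analysis" "Graph_Theory.Digraph_Isomorphism"
begin

text \<open>
  A directed multigraph is a \<^typ>\<open>('a, 'b) pre_digraph\<close> satisfying \<^locale>\<open>fin_digraph\<close> and
  \<^locale>\<open>loopfree_digraph\<close>: arcs are objects of their own, so parallel arcs and directed
  cycles of length 2 are allowed.
\<close>

definition directed_cycle :: "nat \<Rightarrow> (nat, nat) pre_digraph" where
  "directed_cycle k = \<lparr> verts = {..<k}, arcs = {..<k}, tail = (\<lambda>i. i), head = (\<lambda>i. Suc i mod k) \<rparr>"

definition copies :: "('c, 'd) pre_digraph \<Rightarrow> ('a, 'b) pre_digraph \<Rightarrow> ('a, 'b) pre_digraph set" where
  "copies H D = {X. subgraph X D \<and> digraph_iso X H}"

definition del_arcs :: "('a, 'b) pre_digraph \<Rightarrow> 'b set \<Rightarrow> ('a, 'b) pre_digraph" where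
  "del_arcs D F = D\<lparr>arcs := arcs D - F\<rparr>"

definition hitting_set :: "('c, 'd) pre_digraph \<Rightarrow> ('a, 'b) pre_digraph \<Rightarrow> 'b set \<Rightarrow> bool" where
  "hitting_set H D F \<longleftrightarrow> F \<subseteq> arcs D \<and> copies H (del_arcs D F) = {}"

definition tau :: "('c, 'd) pre_digraph \<Rightarrow> ('a, 'b) pre_digraph \<Rightarrow> ('b \<Rightarrow> real) \<Rightarrow> real" where
  "tau H D w = Min {sum w F | F. hitting_set H D F}"

definition fractional_packing ::
  "('c, 'd) pre_digraph \<Rightarrow> ('a, 'b) pre_digraph \<Rightarrow> ('b \<Rightarrow> real) \<Rightarrow> (('a, 'b) pre_digraph \<Rightarrow> real) \<Rightarrow> bool"
where
  "fractional_packing H D w m \<longleftrightarrow>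
     (\<forall>X\<in>copies H D. 0 \<le> m X) \<and>
     (\<forall>e\<in>arcs D. (\<Sum>X | X \<in> copies H D \<and> e \<in> arcs X. m X) \<le> w e)"

text \<open>
  The supremum below is a maximum as soon as \<^term>\<open>D\<close> is finite and \<^term>\<open>H\<close> has an arc,
  see \<open>nu_star_attained\<close>.
\<close>

definition nu_star :: "('c, 'd) pre_digraph \<Rightarrow> ('a, 'b) pre_digraph \<Rightarrow> ('b \<Rightarrow> real) \<Rightarrow> real" where
  "nu_star H D w = Sup {sum m (copies H D) | m. fractional_packing H D w m}"

lemma finite_copies:
  assumes "fin_digraph D"
  shows "finite (copies H D)"
proof -
  interpret fin_digraph D by fact
  have "copies H D \<subseteq> (\<lambda>(V, A). \<lparr>verts = V, arcs = A, tail = tail D, head = head D\<rparr>) `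
      (Pow (verts D) \<times> Pow (arcs D))"
  proof
    fix X assume "X \<in> copies H D"
    then have s: "subgraph X D" by (simp add: copies_def)
    then have "X = \<lparr>verts = verts X, arcs = arcs X, tail = tail D, head = head D\<rparr>"
      by (auto simp: subgraph_def compatible_def)
    with s show "X \<in> (\<lambda>(V, A). \<lparr>verts = V, arcs = A, tail = tail D, head = head D\<rparr>) `
      (Pow (verts D) \<times> Pow (arcs D))"
      by (intro image_eqI[of _ _ "(verts X, arcs X)"]) (auto simp: subgraph_def)
  qed
  then show ?thesis by (rule finite_subset) simp
qed

lemma copies_arcs_nonempty:
  assumes "arcs H \<noteq> {}" "X \<in> copies H D"
  shows "arcs X \<noteq> {}" "arcs X \<subseteq> arcs D"
  using assms by (auto simp: copies_def digraph_iso_def subgraph_def)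

lemma tau_attained:
  assumes "fin_digraph D" "arcs H \<noteq> {}"
  shows "\<exists>F. hitting_set H D F \<and> tau H D w = sum w F"
    and "hitting_set H D F \<Longrightarrow> tau H D w \<le> sum w F"
proof -
  interpret fin_digraph D by fact
  have eq: "{sum w F | F. hitting_set H D F} = sum w ` {F. hitting_set H D F}" by auto
  have "{F. hitting_set H D F} \<subseteq> Pow (arcs D)" by (auto simp: hitting_set_def)
  then have fin: "finite {sum w F | F. hitting_set H D F}"
    unfolding eq using finite_arcs by (meson finite_Pow_iff finite_imageI finite_subset)
  have "copies H (del_arcs D (arcs D)) = {}"
    using copies_arcs_nonempty[OF assms(2)] by (fastforce simp: del_arcs_def)
  then have "hitting_set H D (arcs D)" by (simp add: hitting_set_def)
  then have "{sum w F | F. hitting_set H D F} \<noteq> {}" by blast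
  from Min_in[OF fin this] show "\<exists>F. hitting_set H D F \<and> tau H D w = sum w F"
    by (auto simp: tau_def)
  show "hitting_set H D F \<Longrightarrow> tau H D w \<le> sum w F"
    unfolding tau_def by (rule Min_le[OF fin]) blast
qed

lemma nu_star_attained:
  assumes "fin_digraph D" "arcs H \<noteq> {}" "\<And>e. e \<in> arcs D \<Longrightarrow> 0 \<le> w e"
  shows "\<exists>m. fractional_packing H D w m \<and> nu_star H D w = sum m (copies H D)"
    and "fractional_packing H D w m \<Longrightarrow> sum m (copies H D) \<le> nu_star H D w"
proof -
  interpret fin_digraph D by fact
  let ?C = "copies H D" and ?W = "sum w (arcs D)"
  let ?V = "{sum m ?C | m. fractional_packing H D w m}"
  have finC: "finite ?C" by (rule finite_copies) fact
  define B where "B X = (if X \<in> ?C then {0..?W} else {0})" for X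
  define K where "K = Pi\<^sub>E UNIV B \<inter>
    (\<Inter>e\<in>arcs D. {m. (\<Sum>X | X \<in> ?C \<and> e \<in> arcs X. m X) \<le> w e})"
  have "compactin (product_topology (\<lambda>_. euclidean) UNIV) (Pi\<^sub>E UNIV B)"
    unfolding compactin_PiE by (auto simp: B_def)
  then have "compact (Pi\<^sub>E UNIV B)"
    by (simp add: euclidean_product_topology)
  moreover have cont: "continuous_on UNIV (\<lambda>m::('a,'b) pre_digraph \<Rightarrow> real. sum m A)" for A
    by (intro continuous_on_sum continuous_on_product_coordinates)
  then have "closed {m. (\<Sum>X | X \<in> ?C \<and> e \<in> arcs X. m X) \<le> w e}" for e
    by (intro closed_Collect_le continuous_on_const)
  ultimately have cK: "compact K"
    unfolding K_def by (intro compact_Int_closed closed_INT) auto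
  have pK: "fractional_packing H D w m" if "m \<in> K" for m
    using that by (auto simp: K_def B_def fractional_packing_def PiE_iff split: if_splits)
  have Kp: "(\<lambda>X. if X \<in> ?C then m X else 0) \<in> K" if p: "fractional_packing H D w m" for m
  proof -
    have "m X \<in> {0..?W}" if X: "X \<in> ?C" for X
    proof -
      from copies_arcs_nonempty[OF assms(2) X] obtain e where e: "e \<in> arcs X" "e \<in> arcs D" by blast
      have "m X \<le> (\<Sum>X | X \<in> ?C \<and> e \<in> arcs X. m X)"
        using p finC X e by (intro member_le_sum) (auto simp: fractional_packing_def)
      also have "\<dots> \<le> w e" using p e by (simp add: fractional_packing_def)
      also have "\<dots> \<le> ?W" using assms(3) e by (intro member_le_sum) auto
      finally show ?thesis using p X by (simp add: fractional_packing_def)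
    qed
    moreover have "(\<Sum>X | X \<in> ?C \<and> e \<in> arcs X. if X \<in> ?C then m X else 0) = (\<Sum>X | X \<in> ?C \<and> e \<in> arcs X. m X)" for e
      by (rule sum.cong) auto
    ultimately show ?thesis using p by (auto simp: K_def B_def fractional_packing_def)
  qed
  have "fractional_packing H D w (\<lambda>_. 0)" using assms(3) by (simp add: fractional_packing_def)
  from Kp[OF this] have "K \<noteq> {}" by blast
  then obtain m0 where m0: "m0 \<in> K" "\<And>m. m \<in> K \<Longrightarrow> sum m ?C \<le> sum m0 ?C"
    using continuous_attains_sup[OF cK _ continuous_on_subset[OF cont[of ?C]]] by blast
  have max: "sum m ?C \<le> sum m0 ?C" if "fractional_packing H D w m" for m
    using m0(2)[OF Kp[OF that]] by simp
  have "nu_star H D w = sum m0 ?C"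
    unfolding nu_star_def using max pK[OF m0(1)] by (intro cSup_eq_maximum) auto
  with max pK[OF m0(1)] show "\<exists>m. fractional_packing H D w m \<and> nu_star H D w = sum m (copies H D)"
    and "fractional_packing H D w m \<Longrightarrow> sum m (copies H D) \<le> nu_star H D w" by auto
qed

end

theory Submission
  imports Defs
begin

text \<open>
  Let \<open>c\<close> be an optimal fractional cover, which by LP duality has value \<open>\<nu>\<^sup>*\<close>, and put
  \<open>\<alpha> = k (L + 1) / (2 L)\<close>. An arc \<open>f\<close> with \<open>c f \<ge> 1 / \<alpha>\<close> can be deleted: this lowers
  \<open>\<alpha> \<nu>\<^sup>*\<close> by at least \<open>w f\<close>. If no such arc is left, let \<open>P\<close> be the set of arcs with \<open>c > 0\<close>.
  By complementary slackness they are saturated, so \<open>w P \<le> k \<nu>\<^sup>*\<close>; and every \<open>k\<close>-cycle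
  has fewer than \<open>k - \<alpha>\<close> arcs outside \<open>P\<close>, hence \<open>L\<close> consecutive arcs in \<open>P\<close>. Assign to every
  vertex a uniformly random level in \<open>{0, \<dots>, L - 1}\<close> and delete the arcs of \<open>P\<close> along which the
  level does not increase. The deleted weight is \<open>(L + 1) / (2 L) \<cdot> w P \<le> \<alpha> \<nu>\<^sup>*\<close> on average,
  and no \<open>L\<close> consecutive arcs of \<open>P\<close> survive. Take \<open>L = 3\<close> in general and \<open>L = 4\<close> for \<open>k = 5\<close>.
\<close>

section \<open>Duality of fractional packings and fractional covers\<close>

text \<open>The derivative \<open>2 * max 0 a\<close> of the squared positive part has Lipschitz
  constant 2; this is the resulting Taylor bound, for \<open>h\<close> of either sign.\<close>

lemma pos_part_square_add_le:
  fixes a h :: real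
  shows "(max 0 (a + h))\<^sup>2 \<le> (max 0 a)\<^sup>2 + 2 * h * max 0 a + h\<^sup>2"
proof -
  have "(max 0 (a + h))\<^sup>2 \<le> (max 0 a + h)\<^sup>2"
    by (rule abs_le_square_iff[THEN iffD1]) (auto simp: max_def abs_if)
  then show ?thesis by (simp add: power2_eq_square algebra_simps)
qed

text \<open>First-order optimality: divide by \<open>h\<close> and let it tend to 0. For negative
  \<open>d\<close>, the explicit step \<open>min \<delta> (- d / N)\<close> already gives a
  contradiction.\<close>

lemma nonneg_of_quadratic_nonneg:
  fixes d N \<delta> :: real
  assumes "\<And>h. 0 < h \<Longrightarrow> h \<le> \<delta> \<Longrightarrow> 0 \<le> 2 * h * d + h\<^sup>2 * N" "0 < \<delta>" "0 < N"
  shows "0 \<le> d"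
proof (rule ccontr)
  assume "\<not> 0 \<le> d"
  define h where "h = min \<delta> (- d / N)"
  have h: "0 < h" "h \<le> \<delta>" "h * N \<le> - d"
    using assms(2,3) \<open>\<not> 0 \<le> d\<close> by (auto simp: h_def min_def field_simps)
  have "0 \<le> h * (2 * d + h * N)"
    using assms(1)[OF h(1,2)] by (simp add: power2_eq_square algebra_simps)
  then have "0 \<le> 2 * d + h * N" using h(1) by (simp add: zero_le_mult_iff)
  with h(3) \<open>\<not> 0 \<le> d\<close> show False by linarith
qed

text \<open>Tychonoff's theorem. Functions are total, so coordinates outside \<open>S\<close> are
  pinned to 0 to keep the box compact.\<close>

lemma compact_box:
  fixes b :: real
  shows "compact (Pi\<^sub>E UNIV (\<lambda>x. if x \<in> S then {0..b} else {0}))"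
proof -
  have "compactin (product_topology (\<lambda>_. euclidean) UNIV) (Pi\<^sub>E UNIV (\<lambda>x. if x \<in> S then {0..b} else {0}))"
    unfolding compactin_PiE by auto
  then show ?thesis by (simp add: euclidean_product_topology)
qed

text \<open>Strong LP duality by penalty minimisation: at a minimum, overloads divided by the
  shortfall \<open>t m\<close> form a cover. The strict bound on packings is what makes
  \<open>t m\<close> positive.\<close>

lemma fractional_cover_less:
  fixes A :: "'j \<Rightarrow> 'i set" and w :: "'i \<Rightarrow> real"
  assumes fin: "finite J" "finite E" and A: "\<And>j. j \<in> J \<Longrightarrow> A j \<subseteq> E"
    and w: "\<And>e. e \<in> E \<Longrightarrow> 0 \<le> w e"
    and bound: "\<And>m. \<lbrakk>\<forall>j\<in>J. 0 \<le> m j; \<forall>e\<in>E. (\<Sum>j | j \<in> J \<and> e \<in> A j. m j) \<le> w e\<rbrakk> \<Longrightarrow> sum m J < \<beta>"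
  shows "\<exists>c. (\<forall>e\<in>E. 0 \<le> c e) \<and> (\<forall>j\<in>J. 1 \<le> sum c (A j)) \<and> (\<Sum>e\<in>E. c e * w e) \<le> \<beta>"
proof -
  have \<beta>: "0 < \<beta>" using bound[of "\<lambda>_. 0"] w by simp
  define load where "load m e = (\<Sum>j | j \<in> J \<and> e \<in> A j. m j)" for m :: "'j \<Rightarrow> real" and e
  define r where "r m e = max 0 (load m e - w e)" for m e
  define t where "t m = max 0 (\<beta> - sum m J)" for m
  \<comment> \<open>Penalty function of the infeasible system ``packing of value at least \<open>\<beta>\<close>''; the
    residuals at a minimum are, up to scaling, the required cover.\<close>
  define \<Phi> where "\<Phi> m = (\<Sum>e\<in>E. (r m e)\<^sup>2) + (t m)\<^sup>2" for m
  \<comment> \<open>The upper bound \<open>\<beta>\<close> serves compactness only;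
    \<open>lt\<close> below shows that it is never active at the minimum.\<close>
  define K where "K = Pi\<^sub>E UNIV (\<lambda>j. if j \<in> J then {0..\<beta>} else {0})"
  have cont: "continuous_on UNIV (\<lambda>m::'j \<Rightarrow> real. sum m B)" for B
    by (intro continuous_on_sum continuous_on_product_coordinates)
  have "continuous_on UNIV \<Phi>"
    unfolding \<Phi>_def r_def t_def load_def by (intro continuous_intros cont)
  moreover have "compact K" unfolding K_def by (rule compact_box)
  moreover have "(\<lambda>_. 0) \<in> K" using \<beta> by (auto simp: K_def)
  ultimately obtain m where m: "m \<in> K" and min: "\<And>m'. m' \<in> K \<Longrightarrow> \<Phi> m \<le> \<Phi> m'"
    using continuous_attains_inf[of K \<Phi>] continuous_on_subset by blast
  have m0: "0 \<le> m j" and m1: "m j \<le> \<beta>" if "j \<in> J" for j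
    using m that unfolding K_def PiE_iff by (metis UNIV_I atLeastAtMost_iff)+
  have m2: "m j = 0" if "j \<notin> J" for j
    using m that unfolding K_def PiE_iff by (auto split: if_splits)
  \<comment> \<open>Changing one coordinate by \<open>h\<close> shifts each affine residual by 0,
    \<open>h\<close> or \<open>- h\<close>, so the first-order term is the partial derivative of
    \<open>\<Phi>\<close> times \<open>h\<close>.\<close>
  have upd: "\<Phi> (m(j := m j + h)) \<le> \<Phi> m + 2 * h * (sum (r m) (A j) - t m) + h\<^sup>2 * (card (A j) + 1)"
    if j: "j \<in> J" for j h
  proof -
    let ?m = "m(j := m j + h)"
    have m': "?m = (\<lambda>i. m i + (if i = j then h else 0))" by auto
    have s: "sum ?m B = sum m B + (if j \<in> B then h else 0)" if "finite B" for B
      unfolding m' using that by (simp add: sum.distrib)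
    have l: "load ?m e = load m e + (if e \<in> A j then h else 0)" for e
      unfolding load_def using s[of "{i \<in> J. e \<in> A i}"] fin j by simp
    have "(r ?m e)\<^sup>2 \<le> (r m e)\<^sup>2 + (if e \<in> A j then 2 * h * r m e + h\<^sup>2 else 0)" for e
    proof -
      have "r ?m e = max 0 (load m e - w e + (if e \<in> A j then h else 0))"
        by (simp add: r_def l)
      then show ?thesis
        using pos_part_square_add_le[of "load m e - w e" h] by (simp add: r_def)
    qed
    then have "(\<Sum>e\<in>E. (r ?m e)\<^sup>2) \<le> (\<Sum>e\<in>E. (r m e)\<^sup>2 + (if e \<in> A j then 2 * h * r m e + h\<^sup>2 else 0))"
      by (intro sum_mono)
    also have "\<dots> = (\<Sum>e\<in>E. (r m e)\<^sup>2) + (\<Sum>e\<in>A j. 2 * h * r m e + h\<^sup>2)"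
      using fin A[OF j] by (simp add: sum.distrib sum.inter_restrict[symmetric] Int_absorb1)
    also have "(\<Sum>e\<in>A j. 2 * h * r m e + h\<^sup>2) = 2 * h * sum (r m) (A j) + h\<^sup>2 * card (A j)"
      by (simp add: sum.distrib sum_distrib_left)
    finally have 1: "(\<Sum>e\<in>E. (r ?m e)\<^sup>2) \<le>
      (\<Sum>e\<in>E. (r m e)\<^sup>2) + (2 * h * sum (r m) (A j) + h\<^sup>2 * card (A j))" .
    have 2: "(t ?m)\<^sup>2 \<le> (t m)\<^sup>2 - 2 * h * t m + h\<^sup>2"
      using pos_part_square_add_le[of "\<beta> - sum m J" "- h"] s[OF fin(1)] j
      by (simp add: t_def algebra_simps)
    show ?thesis using 1 2 by (simp add: \<Phi>_def algebra_simps)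
  qed
  \<comment> \<open>Optimality conditions: a coordinate below \<open>\<beta>\<close> may grow, a
    positive one may shrink (\<open>down\<close>). Where both apply,
    \<open>sum (r m) (A j) = t m\<close>.\<close>
  have up: "t m \<le> sum (r m) (A j)" if j: "j \<in> J" "m j < \<beta>" for j
  proof -
    have "0 \<le> 2 * h * (sum (r m) (A j) - t m) + h\<^sup>2 * (card (A j) + 1)"
      if "0 < h" "h \<le> \<beta> - m j" for h
    proof -
      have "m(j := m j + h) \<in> K" using m0 m1 m2 that j m0[OF j(1)] by (auto simp: K_def)
      from min[OF this] upd[OF j(1), of h] show ?thesis by linarith
    qed
    from nonneg_of_quadratic_nonneg[OF this] j(2) show ?thesis by simp
  qed
  have down: "sum (r m) (A j) \<le> t m" if j: "j \<in> J" "0 < m j" for j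
  proof -
    have "0 \<le> 2 * h * (t m - sum (r m) (A j)) + h\<^sup>2 * (card (A j) + 1)"
      if "0 < h" "h \<le> m j" for h
    proof -
      have "m(j := m j + (- h)) \<in> K" using m0 m1 m2 that j m1[OF j(1)] by (auto simp: K_def; linarith)
      from min[OF this] upd[OF j(1), of "- h"] show ?thesis by (simp add: algebra_simps)
    qed
    from nonneg_of_quadratic_nonneg[OF this] j(2) show ?thesis by simp
  qed
  have r0: "0 \<le> r m e" for e by (simp add: r_def)
  \<comment> \<open>With \<open>t m = 0\<close>, \<open>down\<close> rules out any overload, so
    \<open>m\<close> would be a packing of value at least \<open>\<beta>\<close>.\<close>
  have t0: "0 < t m"
  proof (rule ccontr)
    assume "\<not> 0 < t m"
    then have t: "t m = 0" and S: "\<beta> \<le> sum m J" by (auto simp: t_def)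
    have "load m e \<le> w e" if e: "e \<in> E" for e
    proof (rule ccontr)
      assume c: "\<not> load m e \<le> w e"
      then have "0 < load m e" using w[OF e] by linarith
      then obtain j where j: "j \<in> J" "e \<in> A j" "0 < m j"
        unfolding load_def by (smt (verit) mem_Collect_eq sum_nonpos)
      have "r m e \<le> sum (r m) (A j)"
        using j A[OF j(1)] fin r0 by (intro member_le_sum) (auto intro: finite_subset)
      with down[OF j(1,3)] t c show False by (simp add: r_def)
    qed
    with bound[of m] m0 S show False by (force simp: load_def)
  qed
  have lt: "m j < \<beta>" if "j \<in> J" for j
    using member_le_sum[of j J m] that m0 fin t0 by (auto simp: t_def)
  \<comment> \<open>Cost of the unscaled cover: after exchanging sums, complementarity replaces each
    \<open>sum (r m) (A j)\<close> by \<open>t m\<close>. Replacing \<open>load\<close> by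
    \<open>w\<close> afterwards can only lower the sum, as \<open>r\<close> vanishes unless the load
    exceeds \<open>w\<close>.\<close>
  have "(\<Sum>e\<in>E. r m e * load m e) = (\<Sum>e\<in>E. \<Sum>j | j \<in> J \<and> e \<in> A j. r m e * m j)"
    by (simp add: load_def sum_distrib_left)
  also have "\<dots> = (\<Sum>j\<in>J. \<Sum>e | e \<in> E \<and> e \<in> A j. r m e * m j)"
    by (rule sum.swap_restrict[OF fin(2,1)])
  also have "\<dots> = (\<Sum>j\<in>J. sum (r m) (A j) * m j)"
    using A by (intro sum.cong refl) (auto simp: sum_distrib_right intro!: sum.cong)
  also have "\<dots> = (\<Sum>j\<in>J. t m * m j)"
  proof (intro sum.cong refl)
    fix j assume j: "j \<in> J"
    then show "sum (r m) (A j) * m j = t m * m j"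
      using up[OF j lt[OF j]] down[OF j] m0[OF j] by (cases "m j = 0") auto
  qed
  also have "\<dots> \<le> t m * \<beta>"
    unfolding sum_distrib_left[symmetric] using t0 by (intro mult_left_mono) (auto simp: t_def)
  finally have "(\<Sum>e\<in>E. r m e * load m e) \<le> t m * \<beta>" .
  moreover have "(\<Sum>e\<in>E. r m e * w e) \<le> (\<Sum>e\<in>E. r m e * load m e)"
    by (intro sum_mono) (auto simp: r_def max_def intro: mult_left_mono)
  ultimately have "(\<Sum>e\<in>E. r m e * w e) \<le> t m * \<beta>" by linarith
  then have "(\<Sum>e\<in>E. r m e / t m * w e) \<le> \<beta>"
    using t0 by (simp add: sum_divide_distrib[symmetric] field_simps)
  moreover have "1 \<le> (\<Sum>e\<in>A j. r m e / t m)" if "j \<in> J" for j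
    using up[OF that lt[OF that]] t0 by (simp add: sum_divide_distrib[symmetric])
  ultimately show ?thesis
    using r0 t0 by (intro exI[of _ "\<lambda>e. r m e / t m"]) (auto simp: less_imp_le)
qed

text \<open>Passage to the limit: covers of cost at most \<open>\<beta>\<close> exist for all
  \<open>\<beta> > \<nu>\<close>, and a cheapest cover exists by compactness.\<close>

lemma fractional_cover_le:
  fixes A :: "'j \<Rightarrow> 'i set" and w :: "'i \<Rightarrow> real"
  assumes fin: "finite J" "finite E" and A: "\<And>j. j \<in> J \<Longrightarrow> A j \<subseteq> E"
    and w: "\<And>e. e \<in> E \<Longrightarrow> 0 \<le> w e"
    and bound: "\<And>m. \<lbrakk>\<forall>j\<in>J. 0 \<le> m j; \<forall>e\<in>E. (\<Sum>j | j \<in> J \<and> e \<in> A j. m j) \<le> w e\<rbrakk> \<Longrightarrow> sum m J \<le> \<nu>"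
  shows "\<exists>c. (\<forall>e\<in>E. 0 \<le> c e) \<and> (\<forall>j\<in>J. 1 \<le> sum c (A j)) \<and> (\<Sum>e\<in>E. c e * w e) \<le> \<nu>"
proof -
  define K where "K = Pi\<^sub>E UNIV (\<lambda>e. if e \<in> E then {0..1::real} else {0}) \<inter> (\<Inter>j\<in>J. {c. 1 \<le> sum c (A j)})"
  have "closed {c::'i \<Rightarrow> real. 1 \<le> sum c (A j)}" for j
    by (intro closed_Collect_le continuous_on_const continuous_on_sum continuous_on_product_coordinates)
  then have cK: "compact K"
    unfolding K_def by (intro compact_Int_closed compact_box closed_INT) auto
  have cont: "continuous_on K (\<lambda>c. \<Sum>e\<in>E. c e * w e)"
    by (intro continuous_intros continuous_on_subset[OF continuous_on_product_coordinates]) auto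
  have approx: "\<exists>c\<in>K. (\<Sum>e\<in>E. c e * w e) \<le> \<beta>" if "\<nu> < \<beta>" for \<beta>
  proof -
    have "\<exists>c. (\<forall>e\<in>E. 0 \<le> c e) \<and> (\<forall>j\<in>J. 1 \<le> sum c (A j)) \<and> (\<Sum>e\<in>E. c e * w e) \<le> \<beta>"
      by (intro fractional_cover_less fin A w le_less_trans[OF bound that])
    then obtain c where c: "\<And>e. e \<in> E \<Longrightarrow> 0 \<le> c e" "\<And>j. j \<in> J \<Longrightarrow> 1 \<le> sum c (A j)"
      "(\<Sum>e\<in>E. c e * w e) \<le> \<beta>" by blast
    \<comment> \<open>Truncating at 1 puts the cover into the compact box; a set containing an
      element of value at least 1 stays covered by that element alone.\<close>
    define c' where "c' e = (if e \<in> E then min 1 (c e) else 0)" for e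
    have "1 \<le> sum c' (A j)" if j: "j \<in> J" for j
    proof (cases "\<exists>e\<in>A j. 1 \<le> c e")
      case True
      then obtain e where e: "e \<in> A j" "1 \<le> c e" by blast
      have "c' e \<le> sum c' (A j)"
        using e A[OF j] fin c(1) by (intro member_le_sum) (auto simp: c'_def intro: finite_subset)
      then show ?thesis using e A[OF j] by (auto simp: c'_def)
    next
      case False
      then have "sum c' (A j) = sum c (A j)"
        using A[OF j] by (intro sum.cong) (auto simp: c'_def min_def)
      then show ?thesis using c(2)[OF j] by simp
    qed
    then have "c' \<in> K" using c(1) by (auto simp: K_def c'_def)
    moreover have "(\<Sum>e\<in>E. c' e * w e) \<le> (\<Sum>e\<in>E. c e * w e)"
      using w by (intro sum_mono mult_right_mono) (auto simp: c'_def)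
    ultimately show ?thesis using c(3) by (meson order_trans)
  qed
  from approx[of "\<nu> + 1"] have "K \<noteq> {}" by auto
  from continuous_attains_inf[OF cK this cont] obtain c where c: "c \<in> K"
    "\<And>c'. c' \<in> K \<Longrightarrow> (\<Sum>e\<in>E. c e * w e) \<le> (\<Sum>e\<in>E. c' e * w e)" by blast
  have "(\<Sum>e\<in>E. c e * w e) \<le> \<nu>"
    by (rule dense_ge) (use approx c(2) in force)
  then show ?thesis using c(1) by (intro exI[of _ c]) (auto simp: K_def PiE_iff split: if_splits)
qed

section \<open>Random levels\<close>

text \<open>Split by the pair \<open>(g u, g v)\<close>: each pair in \<open>S\<close> leaves
  \<open>L\<close> free choices at every other vertex.\<close>

lemma card_functions_with_two_values:
  fixes L :: nat
  assumes "finite V" "u \<in> V" "v \<in> V" "u \<noteq> v" "S \<subseteq> {..<L} \<times> {..<L}"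
  shows "card {g \<in> V \<rightarrow>\<^sub>E {..<L}. (g u, g v) \<in> S} = card S * L ^ card (V - {u, v})"
proof -
  define B where "B p x = (if x = u then {fst p} else if x = v then {snd p} else {..<L})" for p x
  have "{g \<in> V \<rightarrow>\<^sub>E {..<L}. (g u, g v) \<in> S} = (\<Union>p\<in>S. Pi\<^sub>E V (B p))"
  proof (intro equalityI subsetI)
    fix g assume "g \<in> {g \<in> V \<rightarrow>\<^sub>E {..<L}. (g u, g v) \<in> S}"
    then show "g \<in> (\<Union>p\<in>S. Pi\<^sub>E V (B p))"
      by (intro UN_I[of "(g u, g v)"]) (auto simp: B_def PiE_iff)
  next
    fix g assume "g \<in> (\<Union>p\<in>S. Pi\<^sub>E V (B p))"
    then obtain p where p: "p \<in> S" "g \<in> Pi\<^sub>E V (B p)" by blast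
    have "g u \<in> B p u" "g v \<in> B p v" using p(2) assms(2,3) by (auto intro: PiE_mem)
    then have gp: "(g u, g v) = p" using assms(4) by (simp add: B_def)
    moreover have "B p x \<subseteq> {..<L}" for x using p(1) assms(5) by (auto simp: B_def)
    then have "g \<in> V \<rightarrow>\<^sub>E {..<L}" using PiE_mono[of V "B p" "\<lambda>_. {..<L}"] p(2) by blast
    ultimately show "g \<in> {g \<in> V \<rightarrow>\<^sub>E {..<L}. (g u, g v) \<in> S}" using p(1) by simp
  qed
  also have "card \<dots> = (\<Sum>p\<in>S. card (Pi\<^sub>E V (B p)))"
  proof (intro card_UN_disjoint ballI impI)
    show "finite S" using assms(5) by (rule finite_subset) simp
    show "finite (Pi\<^sub>E V (B p))" for p :: "nat \<times> nat" using assms(1) by (intro finite_PiE) (auto simp: B_def)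
    fix p q :: "nat \<times> nat" assume "p \<noteq> q"
    show "Pi\<^sub>E V (B p) \<inter> Pi\<^sub>E V (B q) = {}"
    proof (rule ccontr)
      assume "Pi\<^sub>E V (B p) \<inter> Pi\<^sub>E V (B q) \<noteq> {}"
      then obtain g where "g \<in> Pi\<^sub>E V (B p)" "g \<in> Pi\<^sub>E V (B q)" by blast
      then have "g u \<in> B p u" "g v \<in> B p v" "g u \<in> B q u" "g v \<in> B q v"
        using assms(2,3) by (auto simp: PiE_iff)
      then show False using \<open>p \<noteq> q\<close> assms(4) by (auto simp: B_def prod_eq_iff)
    qed
  qed
  also have "\<dots> = (\<Sum>p\<in>S. L ^ card (V - {u, v}))"
  proof (intro sum.cong refl)
    fix p :: "nat \<times> nat"
    have "card (Pi\<^sub>E V (B p)) = (\<Prod>x\<in>V. card (B p x))" using assms(1) by (rule card_PiE)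
    also have "\<dots> = (\<Prod>x\<in>V - {u, v}. card (B p x))"
      using assms(1) by (intro prod.mono_neutral_right) (auto simp: B_def)
    also have "\<dots> = (\<Prod>x\<in>V - {u, v}. L)" by (intro prod.cong) (auto simp: B_def)
    finally show "card (Pi\<^sub>E V (B p)) = L ^ card (V - {u, v})" by simp
  qed
  finally show ?thesis by simp
qed

text \<open>Of the \<open>L * L\<close> equally frequent level pairs, \<open>L * (L + 1) / 2\<close>
  do not increase. The probability \<open>(L + 1) / (2 * L)\<close> is stated with denominators
  cleared.\<close>

lemma card_nonincreasing_levels:
  fixes L :: nat
  assumes "finite V" "u \<in> V" "v \<in> V" "u \<noteq> v"
  shows "2 * L * card {g \<in> V \<rightarrow>\<^sub>E {..<L}. g v \<le> g u} = (L + 1) * card (V \<rightarrow>\<^sub>E {..<L})"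
proof -
  let ?q = "L ^ card (V - {u, v})" and ?T = "SIGMA a:{..<L}. {..a}"
  have T: "2 * card ?T = L * (L + 1)"
  proof -
    have "2 * (\<Sum>a<L. Suc a) = L * (L + 1)" by (induction L) auto
    then show ?thesis by simp
  qed
  have "card {g \<in> V \<rightarrow>\<^sub>E {..<L}. (g u, g v) \<in> ?T} = card ?T * ?q"
    using assms by (intro card_functions_with_two_values) auto
  moreover have "{g \<in> V \<rightarrow>\<^sub>E {..<L}. (g u, g v) \<in> ?T} = {g \<in> V \<rightarrow>\<^sub>E {..<L}. g v \<le> g u}"
    using assms(2) by (auto simp: PiE_iff)
  ultimately have le: "card {g \<in> V \<rightarrow>\<^sub>E {..<L}. g v \<le> g u} = card ?T * ?q" by simp
  have "card {g \<in> V \<rightarrow>\<^sub>E {..<L}. (g u, g v) \<in> {..<L} \<times> {..<L}} = L * L * ?q"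
    using card_functions_with_two_values[OF assms, of "{..<L} \<times> {..<L}" L] by simp
  moreover have "{g \<in> V \<rightarrow>\<^sub>E {..<L}. (g u, g v) \<in> {..<L} \<times> {..<L}} = V \<rightarrow>\<^sub>E {..<L}"
    using assms(2,3) PiE_mem by fastforce
  ultimately have all: "card (V \<rightarrow>\<^sub>E {..<L}) = L * L * ?q" by simp
  have "2 * L * (card ?T * ?q) = L * (2 * card ?T) * ?q" by simp
  also have "\<dots> = (L + 1) * (L * L * ?q)" unfolding T by (simp add: algebra_simps)
  finally show ?thesis unfolding le all .
qed

text \<open>Averaging: if every \<open>g\<close> exceeded the bound, summing over all level
  functions would contradict the exact count for each arc.\<close>

lemma exists_levels:
  fixes w :: "'e \<Rightarrow> real" and L :: nat
  assumes "finite V" "finite P" "\<And>e. e \<in> P \<Longrightarrow> t e \<in> V \<and> h e \<in> V \<and> t e \<noteq> h e" "0 < L"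
  shows "\<exists>g. (\<forall>v\<in>V. g v < L) \<and>
    2 * L * (\<Sum>e | e \<in> P \<and> g (h e) \<le> g (t e). w e) \<le> (L + 1) * sum w P"
proof (rule ccontr)
  assume contr: "\<not> ?thesis"
  let ?G = "V \<rightarrow>\<^sub>E {..<L}"
  have finG: "finite ?G" using assms(1) by (intro finite_PiE) auto
  have "?G \<noteq> {}" using assms(4) by (auto simp: PiE_eq_empty_iff)
  have "(\<Sum>g\<in>?G. (L + 1) * sum w P) < (\<Sum>g\<in>?G. 2 * L * (\<Sum>e | e \<in> P \<and> g (h e) \<le> g (t e). w e))"
    using contr finG \<open>?G \<noteq> {}\<close> by (intro sum_strict_mono) (force simp: not_le PiE_iff)+
  also have "\<dots> = 2 * L * (\<Sum>g\<in>?G. \<Sum>e | e \<in> P \<and> g (h e) \<le> g (t e). w e)"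
    by (simp add: sum_distrib_left)
  also have "\<dots> = 2 * L * (\<Sum>e\<in>P. \<Sum>g | g \<in> ?G \<and> g (h e) \<le> g (t e). w e)"
    by (simp add: sum.swap_restrict[OF finG assms(2)])
  also have "\<dots> = (\<Sum>e\<in>P. real (2 * L * card {g \<in> ?G. g (h e) \<le> g (t e)}) * w e)"
    by (simp add: sum_distrib_left mult.assoc)
  also have "\<dots> = (\<Sum>e\<in>P. real ((L + 1) * card ?G) * w e)"
    using assms by (intro sum.cong refl) (subst card_nonincreasing_levels; simp)
  also have "\<dots> = (\<Sum>g\<in>?G. (L + 1) * sum w P)"
    by (simp only: sum_distrib_left[symmetric] sum_constant of_nat_mult)
  finally show False by simp
qed

section \<open>Copies of a directed cycle\<close>

lemma copies_del_arcs:
  assumes "wf_digraph D"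
  shows "copies H (del_arcs D F) = {X \<in> copies H D. arcs X \<inter> F = {}}"
proof -
  have "wf_digraph (del_arcs D F)"
    using assms by (auto simp: wf_digraph_def del_arcs_def)
  then show ?thesis using assms
    by (auto simp: copies_def subgraph_def compatible_def del_arcs_def)
qed

lemma directed_cycle_copy_arcs:
  assumes "X \<in> copies (directed_cycle k) D" "0 < k"
  obtains a where "bij_betw a {..<k} (arcs X)"
    "\<And>i. i < k \<Longrightarrow> head D (a i) = tail D (a (Suc i mod k))"
proof -
  let ?H = "directed_cycle k"
  from assms(1) obtain f where sub: "subgraph X D" and
    f: "pre_digraph.digraph_isomorphism X f" "?H = app_iso f X"
    by (auto simp: copies_def digraph_iso_def)
  have wf: "wf_digraph X" and eq: "tail X = tail D" "head X = head D"
    using sub by (auto simp: subgraph_def compatible_def)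
  have arcsH: "arcs ?H = {..<k}" and tH: "tail ?H i = i" and hH: "head ?H i = Suc i mod k" for i
    by (auto simp: directed_cycle_def)
  have bij: "bij_betw (iso_arcs f) (arcs X) {..<k}"
    using f arcsH by (auto simp: bij_betw_def pre_digraph.digraph_isomorphism_inj_on_arcs)
  \<comment> \<open>The isomorphism runs from the copy to the model cycle, so its inverse on arcs
    lists the copy in cyclic order.\<close>
  define a where "a = inv_into (arcs X) (iso_arcs f)"
  have a: "bij_betw a {..<k} (arcs X)" unfolding a_def by (rule bij_betw_inv_into[OF bij])
  have ia: "iso_arcs f (a i) = i" "a i \<in> arcs X" if "i < k" for i
    using that bij_betw_inv_into_right[OF bij, of i] bij_betwE[OF a] by (auto simp: a_def)
  have "head D (a i) = tail D (a (Suc i mod k))" if i: "i < k" for i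
  proof -
    have i': "Suc i mod k < k" using assms(2) by simp
    have "iso_verts f (head X (a i)) = Suc i mod k"
      using pre_digraph.iso_verts_head[OF f(1) ia(2)[OF i]] hH ia(1)[OF i] f(2) by simp
    also have "\<dots> = iso_verts f (tail X (a (Suc i mod k)))"
      using pre_digraph.iso_verts_tail[OF f(1) ia(2)[OF i']] tH ia(1)[OF i'] f(2) by simp
    finally have "head X (a i) = tail X (a (Suc i mod k))"
      using pre_digraph.iso_verts_eq_iff[OF f(1)] wf ia(2)[OF i] ia(2)[OF i']
      by (simp add: wf_digraph_def)
    then show ?thesis by (simp add: eq)
  qed
  with a that show ?thesis by blast
qed

lemma card_arcs_directed_cycle_copy:
  assumes "X \<in> copies (directed_cycle k) D" "0 < k"
  shows "card (arcs X) = k"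
  using directed_cycle_copy_arcs[OF assms] by (metis bij_betw_same_card card_lessThan)

text \<open>Each arc outside \<open>P\<close> spoils at most \<open>L\<close> of the
  \<open>k\<close> starting positions of a window of length \<open>L\<close>, so some window
  survives. The sequence \<open>b\<close> is periodic, which hides the wrap-around.\<close>

lemma directed_cycle_copy_consecutive:
  assumes X: "X \<in> copies (directed_cycle k) D" and k: "0 < k"
    and few: "L * card (arcs X - P) < k"
  obtains b where "\<And>n. b n \<in> arcs X" "\<And>n. head D (b n) = tail D (b (Suc n))"
    "\<And>n. n < L \<Longrightarrow> b n \<in> P"
proof -
  obtain a where a: "bij_betw a {..<k} (arcs X)"
    and step: "\<And>i. i < k \<Longrightarrow> head D (a i) = tail D (a (Suc i mod k))"
    using directed_cycle_copy_arcs[OF X k] by blast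
  have finX: "finite (arcs X)" using a bij_betw_finite by blast
  define b where "b n = a (n mod k)" for n
  have bX: "b n \<in> arcs X" for n using bij_betwE[OF a] k by (auto simp: b_def)
  have bs: "head D (b n) = tail D (b (Suc n))" for n
    using step[of "n mod k"] k by (simp add: b_def mod_Suc_eq)
  \<comment> \<open>\<open>?B t\<close> collects the starting positions whose window has its arc
    number \<open>t\<close> outside \<open>P\<close>.\<close>
  let ?B = "\<lambda>t. {i \<in> {..<k}. b (i + t) \<notin> P}"
  have inj: "inj_on (\<lambda>i. b (i + t)) {..<k}" for t
  proof (rule inj_onI)
    fix i j assume ij: "i \<in> {..<k}" "j \<in> {..<k}" "b (i + t) = b (j + t)"
    then have "(i + t) mod k = (j + t) mod k"
      using a k by (auto simp: b_def bij_betw_def dest: inj_onD)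
    then have "(int i + int t) mod int k = (int j + int t) mod int k"
      by (metis of_nat_add zmod_int)
    then have "int i mod int k = int j mod int k" by (simp add: mod_eq_dvd_iff)
    then show "i = j" using ij by simp
  qed
  have "card (?B t) \<le> card (arcs X - P)" for t
    using finX bX by (intro card_inj_on_le[OF inj_on_subset[OF inj[of t]]]) auto
  then have "card (\<Union>t<L. ?B t) \<le> L * card (arcs X - P)"
    using sum_bounded_above[of "{..<L}" "\<lambda>t. card (?B t)" "card (arcs X - P)"]
    by (intro order_trans[OF card_UN_le]) auto
  then have "card (\<Union>t<L. ?B t) < card {..<k}" using few by simp
  then have "\<not> {..<k} \<subseteq> (\<Union>t<L. ?B t)"
    using card_mono[of "\<Union>t<L. ?B t" "{..<k}"] by (auto simp del: card_lessThan)
  then obtain i where "i < k" "\<And>t. t < L \<Longrightarrow> b (i + t) \<in> P" by blast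
  then show ?thesis using that[of "\<lambda>n. b (i + n)"] bX bs by simp
qed

section \<open>Covering by rounding\<close>

lemma optimal_fractional_cover:
  assumes D: "fin_digraph D" and H: "arcs H \<noteq> {}" and w: "\<And>e. e \<in> arcs D \<Longrightarrow> 0 \<le> w e"
  obtains c where "\<And>e. e \<in> arcs D \<Longrightarrow> 0 \<le> c e" "\<And>X. X \<in> copies H D \<Longrightarrow> 1 \<le> sum c (arcs X)"
    "(\<Sum>e\<in>arcs D. c e * w e) \<le> nu_star H D w"
proof -
  interpret fin_digraph D by fact
  have "\<exists>c. (\<forall>e\<in>arcs D. 0 \<le> c e) \<and> (\<forall>X\<in>copies H D. 1 \<le> sum c (arcs X)) \<and>
    (\<Sum>e\<in>arcs D. c e * w e) \<le> nu_star H D w"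
    by (intro fractional_cover_le finite_copies[OF D] finite_arcs copies_arcs_nonempty(2)[OF H] w
        nu_star_attained(2)[OF D H]) (simp_all add: fractional_packing_def)
  then show ?thesis using that by blast
qed

section \<open>Weak duality and complementary slackness for packings of copies\<close>

lemma sum_packing_swap:
  fixes c :: "'b \<Rightarrow> real"
  assumes "fin_digraph D" "P \<subseteq> arcs D"
  shows "(\<Sum>e\<in>P. c e * (\<Sum>X | X \<in> copies H D \<and> e \<in> arcs X. m X)) =
    (\<Sum>X\<in>copies H D. m X * sum c (arcs X \<inter> P))"
proof -
  interpret fin_digraph D by fact
  have finP: "finite P" using assms(2) finite_arcs finite_subset by blast
  have "(\<Sum>e\<in>P. c e * (\<Sum>X | X \<in> copies H D \<and> e \<in> arcs X. m X)) =
      (\<Sum>e\<in>P. \<Sum>X | X \<in> copies H D \<and> e \<in> arcs X. c e * m X)"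
    by (simp add: sum_distrib_left)
  also have "\<dots> = (\<Sum>X\<in>copies H D. \<Sum>e | e \<in> P \<and> e \<in> arcs X. c e * m X)"
    by (rule sum.swap_restrict[OF finP finite_copies[OF assms(1)]])
  also have "\<dots> = (\<Sum>X\<in>copies H D. m X * sum c (arcs X \<inter> P))"
    by (intro sum.cong refl) (auto simp: sum_distrib_left mult.commute intro!: sum.cong)
  finally show ?thesis .
qed

text \<open>Weak duality. The intermediate bound by loads is kept because comparing it with the cost
  of an optimal cover yields complementary slackness.\<close>

lemma packing_le_cover:
  assumes D: "fin_digraph D" and H: "arcs H \<noteq> {}"
    and m: "fractional_packing H D w m"
    and c: "\<And>e. e \<in> arcs D \<Longrightarrow> 0 \<le> c e" "\<And>X. X \<in> copies H D \<Longrightarrow> 1 \<le> sum c (arcs X)"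
  shows "sum m (copies H D) \<le> (\<Sum>e\<in>arcs D. c e * (\<Sum>X | X \<in> copies H D \<and> e \<in> arcs X. m X))"
    and "sum m (copies H D) \<le> (\<Sum>e\<in>arcs D. c e * w e)"
proof -
  have "sum m (copies H D) \<le> (\<Sum>X\<in>copies H D. m X * sum c (arcs X \<inter> arcs D))"
  proof (intro sum_mono)
    fix X assume X: "X \<in> copies H D"
    then have "arcs X \<inter> arcs D = arcs X" using copies_arcs_nonempty(2)[OF H] by blast
    then show "m X \<le> m X * sum c (arcs X \<inter> arcs D)"
      using m c(2)[OF X] X mult_left_mono[of 1 "sum c (arcs X)" "m X"]
      by (simp add: fractional_packing_def)
  qed
  then show *: "sum m (copies H D) \<le> (\<Sum>e\<in>arcs D. c e * (\<Sum>X | X \<in> copies H D \<and> e \<in> arcs X. m X))"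
    by (simp add: sum_packing_swap[OF D order_refl])
  also have "\<dots> \<le> (\<Sum>e\<in>arcs D. c e * w e)"
    using m c(1) by (intro sum_mono mult_left_mono) (auto simp: fractional_packing_def)
  finally show "sum m (copies H D) \<le> (\<Sum>e\<in>arcs D. c e * w e)" .
qed

text \<open>Equality throughout weak duality saturates every arc with \<open>c e > 0\<close>. Their
  weight is then their total load, to which a copy \<open>X\<close> contributes at most
  \<open>k * m X\<close>.\<close>

lemma weight_positive_arcs_le:
  assumes D: "fin_digraph D" and H: "arcs H \<noteq> {}" and w: "\<And>e. e \<in> arcs D \<Longrightarrow> 0 \<le> w e"
    and c: "\<And>e. e \<in> arcs D \<Longrightarrow> 0 \<le> c e" "\<And>X. X \<in> copies H D \<Longrightarrow> 1 \<le> sum c (arcs X)"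
      "(\<Sum>e\<in>arcs D. c e * w e) \<le> nu_star H D w"
    and card: "\<And>X. X \<in> copies H D \<Longrightarrow> card (arcs X) = k"
  shows "sum w {e \<in> arcs D. 0 < c e} \<le> k * nu_star H D w"
proof -
  interpret fin_digraph D by fact
  obtain m where m: "fractional_packing H D w m" "nu_star H D w = sum m (copies H D)"
    using nu_star_attained(1)[where w = w, OF D H] w by blast
  let ?load = "\<lambda>e. \<Sum>X | X \<in> copies H D \<and> e \<in> arcs X. m X" and ?P = "{e \<in> arcs D. 0 < c e}"
  have le: "?load e \<le> w e" if "e \<in> arcs D" for e
    using m(1) that by (simp add: fractional_packing_def)
  have "(\<Sum>e\<in>arcs D. c e * (w e - ?load e)) \<le> 0"
    using packing_le_cover(1)[OF D H m(1) c(1,2)] c(3) m(2)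
    by (simp add: right_diff_distrib sum_subtractf)
  moreover have nn: "0 \<le> c e * (w e - ?load e)" if "e \<in> arcs D" for e
    using le[OF that] c(1)[OF that] by simp
  ultimately have "(\<Sum>e\<in>arcs D. c e * (w e - ?load e)) = 0"
    using sum_nonneg[of "arcs D" "\<lambda>e. c e * (w e - ?load e)"] by force
  then have slack: "c e * (w e - ?load e) = 0" if "e \<in> arcs D" for e
    using sum_nonneg_eq_0_iff[of "arcs D" "\<lambda>e. c e * (w e - ?load e)"] nn that by simp
  \<comment> \<open>The factor 1 brings the sum into the shape of
    \<open>sum_packing_swap\<close>.\<close>
  have "sum w ?P = (\<Sum>e\<in>?P. 1 * ?load e)"
  proof (intro sum.cong refl)
    fix e assume "e \<in> ?P"
    then show "w e = 1 * ?load e" using slack[of e] by simp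
  qed
  also have "\<dots> = (\<Sum>X\<in>copies H D. m X * (\<Sum>e\<in>arcs X \<inter> ?P. 1))"
    by (rule sum_packing_swap[OF D]) auto
  also have "\<dots> \<le> (\<Sum>X\<in>copies H D. m X * k)"
  proof (intro sum_mono mult_left_mono)
    fix X assume X: "X \<in> copies H D"
    then have "finite (arcs X)" using copies_arcs_nonempty(2)[OF H] finite_arcs finite_subset by metis
    then have "card (arcs X \<inter> ?P) \<le> k" using card_mono[of "arcs X"] card[OF X] by auto
    then show "(\<Sum>e\<in>arcs X \<inter> ?P. 1) \<le> real k" by simp
    show "0 \<le> m X" using m(1) X by (simp add: fractional_packing_def)
  qed
  also have "\<dots> = k * nu_star H D w" by (simp add: m(2) sum_distrib_left mult.commute)
  finally show ?thesis .
qed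

text \<open>Induction on the number of arcs, with a fresh optimal cover each time. In
  \<open>few\<close>, \<open>z\<close> stands for the number of arcs of a cycle outside
  \<open>P\<close>.\<close>

lemma tau_directed_cycle_le:
  fixes D :: "('a, 'b) pre_digraph" and w :: "'b \<Rightarrow> real" and k L :: nat and \<alpha> :: real
  assumes "fin_digraph D" "loopfree_digraph D" "\<And>e. e \<in> arcs D \<Longrightarrow> 0 \<le> w e"
    and k: "0 < k" and L: "0 < L" and \<alpha>: "\<alpha> = k * (L + 1) / (2 * L)"
    and few: "\<And>z::nat. z < k - \<alpha> \<Longrightarrow> L * z < k"
  shows "tau (directed_cycle k) D w \<le> \<alpha> * nu_star (directed_cycle k) D w"
  using assms(1-3)
proof (induction "card (arcs D)" arbitrary: D rule: less_induct)
  case less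
  note D = less.prems(1) and w = less.prems(3)
  interpret fin_digraph D by fact
  interpret loopfree_digraph D by fact
  let ?H = "directed_cycle k"
  have H: "arcs ?H \<noteq> {}" using k by (auto simp: directed_cycle_def)
  have \<alpha>0: "0 < \<alpha>" unfolding \<alpha> using k L by (intro divide_pos_pos) (auto simp: add_pos_nonneg)
  obtain c where c: "\<And>e. e \<in> arcs D \<Longrightarrow> 0 \<le> c e" "\<And>X. X \<in> copies ?H D \<Longrightarrow> 1 \<le> sum c (arcs X)"
    "(\<Sum>e\<in>arcs D. c e * w e) \<le> nu_star ?H D w"
    using optimal_fractional_cover[where w = w, OF D H] w by blast
  show ?case
  proof (cases "\<exists>f\<in>arcs D. 1 / \<alpha> \<le> c f")
    case True
    then obtain f where f: "f \<in> arcs D" "1 / \<alpha> \<le> c f" by blast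
    let ?D = "del_arcs D {f}"
    have arcs': "arcs ?D = arcs D - {f}" by (simp add: del_arcs_def)
    have D': "fin_digraph ?D" "loopfree_digraph ?D"
      using no_loops by (unfold_locales; auto simp: del_arcs_def)+
    have w': "\<And>e. e \<in> arcs ?D \<Longrightarrow> 0 \<le> w e" using w by (simp add: arcs')
    have IH: "tau ?H ?D w \<le> \<alpha> * nu_star ?H ?D w"
      using card_Diff1_less[OF finite_arcs f(1)] by (intro less.hyps D' w') (auto simp: arcs')
    obtain m where m: "fractional_packing ?H ?D w m" "nu_star ?H ?D w = sum m (copies ?H ?D)"
      using nu_star_attained(1)[where w = w, OF D'(1) H] w' by blast
    \<comment> \<open>The old cover still covers the copies that avoid \<open>f\<close>, at a cost
      smaller by \<open>c f * w f\<close>.\<close>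
    have "nu_star ?H ?D w \<le> (\<Sum>e\<in>arcs ?D. c e * w e)"
      unfolding m(2) using c(1,2)
      by (intro packing_le_cover(2)[OF D'(1) H m(1)]) (auto simp: arcs' copies_del_arcs[OF wf_digraph_axioms])
    also have "\<dots> = (\<Sum>e\<in>arcs D. c e * w e) - c f * w f"
      using f(1) by (simp add: arcs' sum_diff1)
    finally have nu: "nu_star ?H ?D w \<le> nu_star ?H D w - c f * w f" using c(3) by linarith
    obtain F where F: "hitting_set ?H ?D F" "tau ?H ?D w = sum w F"
      using tau_attained(1)[OF D'(1) H] by blast
    have "hitting_set ?H D (insert f F)"
      using F(1) f(1) by (auto simp: hitting_set_def copies_del_arcs[OF wf_digraph_axioms]
        copies_del_arcs[OF fin_digraph.axioms(1)[OF D'(1)]] arcs')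
    then have "tau ?H D w \<le> sum w (insert f F)" by (rule tau_attained(2)[OF D H])
    also have "\<dots> = w f + sum w F"
      using F(1) finite_subset[OF _ finite_arcs, of F] by (subst sum.insert) (auto simp: hitting_set_def arcs')
    also have "\<dots> \<le> w f + \<alpha> * (nu_star ?H D w - c f * w f)"
      using IH F(2) nu \<alpha>0 mult_left_mono[OF nu, of \<alpha>] by linarith
    also have "\<dots> \<le> \<alpha> * nu_star ?H D w"
    proof -
      have "1 \<le> \<alpha> * c f" using f(2) \<alpha>0 by (simp add: field_simps)
      from mult_right_mono[OF this w[OF f(1)]] show ?thesis by (simp add: algebra_simps)
    qed
    finally show ?thesis .
  next
    case False
    define P where "P = {e \<in> arcs D. 0 < c e}"
    have "\<exists>g. (\<forall>v\<in>verts D. g v < L) \<and>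
      2 * L * (\<Sum>e | e \<in> P \<and> g (head D e) \<le> g (tail D e). w e) \<le> (L + 1) * sum w P"
      using L no_loops by (intro exists_levels) (auto simp: P_def)
    then obtain g where g: "\<And>v. v \<in> verts D \<Longrightarrow> g v < L"
      and sumF: "2 * L * (\<Sum>e | e \<in> P \<and> g (head D e) \<le> g (tail D e). w e) \<le> (L + 1) * sum w P"
      by blast
    define F where "F = {e \<in> P. g (head D e) \<le> g (tail D e)}"
    have "arcs X \<inter> F \<noteq> {}" if X: "X \<in> copies ?H D" for X
    proof
      assume empty: "arcs X \<inter> F = {}"
      have XD: "arcs X \<subseteq> arcs D" using copies_arcs_nonempty(2)[OF H X] .
      then have finX: "finite (arcs X)" using finite_arcs by (rule finite_subset)
      have cardX: "card (arcs X) = k" by (rule card_arcs_directed_cycle_copy[OF X k])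
      have "1 \<le> sum c (arcs X)" by (rule c(2)[OF X])
      also have "sum c (arcs X) = sum c (arcs X \<inter> P)"
        using finX XD c(1) by (intro sum.mono_neutral_right) (auto simp: P_def less_le)
      finally have 1: "1 \<le> sum c (arcs X \<inter> P)" .
      then have "arcs X \<inter> P \<noteq> {}" by auto
      \<comment> \<open>All values of \<open>c\<close> are below \<open>1 / \<alpha>\<close>, so
        reaching 1 takes more than \<open>\<alpha>\<close> arcs of \<open>P\<close>.\<close>
      then have "sum c (arcs X \<inter> P) < (\<Sum>e\<in>arcs X \<inter> P. 1 / \<alpha>)"
        using False finX XD by (intro sum_strict_mono) (auto simp: not_le)
      with 1 have "1 < (\<Sum>e\<in>arcs X \<inter> P. 1 / \<alpha>)" by linarith
      with \<alpha>0 have "\<alpha> < card (arcs X \<inter> P)" by (simp add: field_simps)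
      moreover have "card (arcs X - P) + card (arcs X \<inter> P) = k"
        using cardX card_Diff_subset_Int[of "arcs X" P] finX card_mono[of "arcs X" "arcs X \<inter> P"] by auto
      ultimately have "card (arcs X - P) < k - \<alpha>" by linarith
      then have "L * card (arcs X - P) < k" by (rule few)
      then obtain b where b: "\<And>n. b n \<in> arcs X" "\<And>n. head D (b n) = tail D (b (Suc n))"
        "\<And>n. n < L \<Longrightarrow> b n \<in> P"
        using directed_cycle_copy_consecutive[OF X k] by metis
      \<comment> \<open>Levels rise strictly along the \<open>L\<close> surviving arcs. At
        \<open>n = L\<close> this concerns the end of the last one, which would need level at least
        \<open>L\<close>; \<open>b L\<close> itself may lie outside \<open>P\<close>.\<close>
      have "n \<le> g (tail D (b n))" if "n \<le> L" for n
        using that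
      proof (induction n)
        case (Suc n)
        have "b n \<notin> F" using b(1) empty by blast
        then have "g (tail D (b n)) < g (head D (b n))" using b(3)[of n] Suc.prems by (auto simp: F_def)
        then show ?case using Suc b(2)[of n] by simp
      qed simp
      from this[of L] g[of "tail D (b L)"] b(1)[of L] XD show False by auto
    qed
    then have "hitting_set ?H D F"
      by (auto simp: hitting_set_def copies_del_arcs[OF wf_digraph_axioms] F_def P_def)
    then have "tau ?H D w \<le> sum w F" by (rule tau_attained(2)[OF D H])
    also have "\<dots> \<le> (L + 1) / (2 * L) * sum w P"
      using sumF L by (simp add: F_def field_simps)
    also have "\<dots> \<le> (L + 1) / (2 * L) * (k * nu_star ?H D w)"
      unfolding P_def using card_arcs_directed_cycle_copy k
      by (intro mult_left_mono weight_positive_arcs_le[OF D H w c]) auto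
    also have "\<dots> = \<alpha> * nu_star ?H D w" by (simp add: \<alpha> algebra_simps)
    finally show ?thesis .
  qed
qed

theorem theorem1p2:
  fixes D :: "('a, 'b) pre_digraph" and w :: "'b \<Rightarrow> real"
  assumes "fin_digraph D" and "loopfree_digraph D"
    and "\<And>e. e \<in> arcs D \<Longrightarrow> 0 \<le> w e"
  shows "(\<forall>k\<ge>3. tau (directed_cycle k) D w \<le> (2 * real k / 3) * nu_star (directed_cycle k) D w) \<and>
         tau (directed_cycle 5) D w \<le> (25 / 8) * nu_star (directed_cycle 5) D w"
proof (intro conjI allI impI)
  fix k :: nat assume "3 \<le> k"
  then show "tau (directed_cycle k) D w \<le> (2 * real k / 3) * nu_star (directed_cycle k) D w"
    \<comment> \<open>Here \<open>\<alpha> = 2 * k / 3\<close>, and \<open>few\<close> says that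
      \<open>z < k / 3\<close> implies \<open>3 * z < k\<close>.\<close>
    by (intro tau_directed_cycle_le[where L = 3] assms) (auto simp: field_simps)
next
  show "tau (directed_cycle 5) D w \<le> (25 / 8) * nu_star (directed_cycle 5) D w"
  \<comment> \<open>Here \<open>\<alpha> = 25 / 8\<close>, leaving fewer than \<open>15 / 8\<close>
    arcs outside \<open>P\<close>; integrality makes this at most one, so a run of 4
    remains.\<close>
  proof (intro tau_directed_cycle_le[where L = 4] assms)
    fix z :: nat assume "real z < real 5 - 25 / 8"
    then have "z < 2" by linarith
    then show "4 * z < 5" by simp
  qed simp_all
qed

end
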